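(* Let $I\subset T_n$ be a nonzero monomial ideal with $\deg(I)=d$. Let $1\le k\le n$, $1\le j_1<\cdots<j_k\le n$ and $d_1,\ldots,d_k\ge 1$ be integers. Let $J=(I,x_{j_1}^{d_1},\ldots,x_{j_k}^{d_k})\subset T_n$ and assume that $G(J)=G(I)\cup\{x_{j_1}^{d_1},\ldots,x_{j_k}^{d_k}\}$. For a monomial $u\in T_n$ and $1\le\ell\le k$, let $u^{(\ell)}$ be the monomial obtained from $u$ by replacing $x_{j_\ell+1},\ldots,x_n$ with $1$. Then: (1) If $d_\ell\ge\max\{\deg(u^{(\ell)}) : u\in G(I),\ x_{j_\ell}\mid u\}$ for all $1\le\ell\le k$ (a condition that is vacuous for those $\ell$ for which this set is empty) and $I$ is smoothly spreadable, then $J$ is smoothly spreadable. (2) If $J$ is smoothly spreadable, then $I$ is smoothly spreadable.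
   Context: $K$ is a field, $T=K[x_1,x_2,\ldots]$ and $T_n=K[x_1,\ldots,x_n]$. For a monomial $u=x_{i_1}\cdots x_{i_d}$ with $i_1\le\cdots\le i_d$, set $\sigma(u):=x_{i_1}x_{i_2+1}\cdots x_{i_d+d-1}$, and $\sigma^t(u):=\sigma(\sigma^{t-1}(u))$, so $\sigma^t(u)=x_{i_1}x_{i_2+t}\cdots x_{i_d+(d-1)t}$. For a nonzero monomial ideal $I$, $G(I)$ is its set of minimal monomial generators and $\deg(I)$ is the maximal degree of an element of $G(I)$. For a monomial $u=x_1^{a_1}\cdots x_n^{a_n}\in T_n$, its polarization is $u^p:=\prod_{j=1}^n\prod_{k=0}^{a_j-1}x_{kn+j}$. A monomial ideal $I\subset T_n$ with $\deg(I)=d$ is smoothly spreadable if there is a permutation $\tau$ of $\{1,\ldots,nd\}$ with $\tau(j)\equiv j\pmod n$ for all $j$ such that the $K$-algebra isomorphism $\Phi:T_{nd}\to T_{nd}$, $\Phi(x_j)=x_{\tau(j)}$, satisfies $\Phi(\sigma^n(u))=u^p$ for all $u\in G(I)$. *)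

theory Defs
  imports "HOL-Library.Poly_Mapping" "HOL-Algebra.QuotRing" "HOL-Combinatorics.Permutations"
    "HOL-Number_Theory.Cong"
begin

text \<open>
  A monomial in \<open>x\<^sub>1, x\<^sub>2, \<dots>\<close> is its exponent vector, so products of monomials are sums of
  exponent vectors; a polynomial maps exponent vectors to coefficients. Variables are numbered
  from 1, so index 0 does not occur in the rings \<open>T n\<close> below.
\<close>

type_synonym mon = "nat \<Rightarrow>\<^sub>0 nat"
type_synonym 'k mpoly = "(nat \<Rightarrow>\<^sub>0 nat) \<Rightarrow>\<^sub>0 'k"

abbreviation "keys \<equiv> Poly_Mapping.keys"
abbreviation "lookup \<equiv> Poly_Mapping.lookup"

definition xpow :: "nat \<Rightarrow> nat \<Rightarrow> mon" where
  "xpow j a = Poly_Mapping.single j a"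

definition of_mon :: "mon \<Rightarrow> 'k::field mpoly" where
  "of_mon u = Poly_Mapping.single u 1"

definition const :: "'k::field \<Rightarrow> 'k mpoly" where
  "const c = Poly_Mapping.single 0 c"

definition mons :: "nat \<Rightarrow> mon set" where
  "mons n = {u. keys u \<subseteq> {1..n}}"

definition mon_dvd :: "mon \<Rightarrow> mon \<Rightarrow> bool" where
  "mon_dvd u v \<longleftrightarrow> (\<exists>w. v = u + w)"

definition mdeg :: "mon \<Rightarrow> nat" where
  "mdeg u = (\<Sum>i\<in>keys u. lookup u i)"

definition T :: "nat \<Rightarrow> ('k::field mpoly) ring" where
  "T n = \<lparr>carrier = {p. keys p \<subseteq> mons n}, monoid.mult = (*), one = 1, zero = 0, add = (+)\<rparr>"

definition mon_ideal_gen :: "nat \<Rightarrow> mon set \<Rightarrow> 'k::field mpoly set" where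
  "mon_ideal_gen n M = genideal (T n) (of_mon ` M)"

definition monomial_ideal :: "nat \<Rightarrow> 'k::field mpoly set \<Rightarrow> bool" where
  "monomial_ideal n I \<longleftrightarrow> (\<exists>M \<subseteq> mons n. I = mon_ideal_gen n M)"

definition is_min_mon_gens :: "nat \<Rightarrow> 'k::field mpoly set \<Rightarrow> mon set \<Rightarrow> bool" where
  "is_min_mon_gens n I M \<longleftrightarrow>
     M \<subseteq> mons n \<and> I = mon_ideal_gen n M \<and> (\<forall>M'. M' \<subset> M \<longrightarrow> mon_ideal_gen n M' \<noteq> I)"

text \<open>Existence and uniqueness are \<open>ex1_min_mon_gens\<close> below.\<close>

definition G :: "nat \<Rightarrow> 'k::field mpoly set \<Rightarrow> mon set" where
  "G n I = (THE M. is_min_mon_gens n I M)"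

text \<open>The maximum exists for \<open>I \<noteq> {0}\<close>: \<open>G n I\<close> is then nonempty, and finite by Dickson's lemma.\<close>

definition ideal_deg :: "nat \<Rightarrow> 'k::field mpoly set \<Rightarrow> nat" where
  "ideal_deg n I = Max (mdeg ` G n I)"

text \<open>The list \<open>[i\<^sub>1, \<dots>, i\<^sub>d]\<close> with \<open>u = x\<^bsub>i\<^sub>1\<^esub> \<cdots> x\<^bsub>i\<^sub>d\<^esub>\<close> and \<open>i\<^sub>1 \<le> \<dots> \<le> i\<^sub>d\<close>.\<close>

definition mon_indices :: "mon \<Rightarrow> nat list" where
  "mon_indices u = concat (map (\<lambda>i. replicate (lookup u i) i) (sorted_list_of_set (keys u)))"

text \<open>List positions start at 0, so position \<open>r\<close> holds \<open>i\<^bsub>r+1\<^esub>\<close>, which is shifted by \<open>r\<close>.\<close>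

definition sigma :: "mon \<Rightarrow> mon" where
  "sigma u = (\<Sum>r<length (mon_indices u). xpow (mon_indices u ! r + r) 1)"

definition polarization :: "nat \<Rightarrow> mon \<Rightarrow> mon" where
  "polarization n u = (\<Sum>j=1..n. \<Sum>k<lookup u j. xpow (k * n + j) 1)"

definition K_algebra_iso :: "nat \<Rightarrow> nat \<Rightarrow> ('k::field mpoly \<Rightarrow> 'k mpoly) \<Rightarrow> bool" where
  "K_algebra_iso m n \<Phi> \<longleftrightarrow> \<Phi> \<in> ring_iso (T m) (T n) \<and> (\<forall>c. \<Phi> (const c) = const c)"

text \<open>
  The isomorphism \<open>\<Phi>\<close> is determined on \<open>T (n * d)\<close> by \<open>\<tau>\<close>; its values outside the carrier are
  irrelevant.
\<close>

definition smoothly_spreadable :: "nat \<Rightarrow> 'k::field mpoly set \<Rightarrow> bool" where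
  "smoothly_spreadable n I \<longleftrightarrow>
     monomial_ideal n I \<and> I \<noteq> {0} \<and>
     (let d = ideal_deg n I in
      \<exists>\<tau>. \<tau> permutes {1..n * d} \<and> (\<forall>j\<in>{1..n * d}. [\<tau> j = j] (mod n)) \<and>
        (\<exists>\<Phi> :: 'k mpoly \<Rightarrow> 'k mpoly. K_algebra_iso (n * d) (n * d) \<Phi> \<and>
          (\<forall>j\<in>{1..n * d}. \<Phi> (of_mon (xpow j 1)) = of_mon (xpow (\<tau> j) 1)) \<and>
          (\<forall>u\<in>G n I. \<Phi> (of_mon ((sigma ^^ n) u)) = of_mon (polarization n u))))"

definition set_to_one :: "nat set \<Rightarrow> mon \<Rightarrow> mon" where
  "set_to_one A u = (\<Sum>i\<in>keys u - A. xpow i (lookup u i))"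


text \<open>Well-definedness of \<open>G\<close>.\<close>

lemma T_simps [simp]:
  "carrier (T n) = {p. keys p \<subseteq> mons n}" "monoid.mult (T n) = (*)" "one (T n) = 1"
  "zero (T n) = 0" "add (T n) = (+)"
  by (simp_all add: T_def)

lemma uminus_keys: "keys (- p) = keys (p :: 'k::field mpoly)"
  by (auto simp: in_keys_iff)

lemma mons_zero [simp]: "0 \<in> mons n"
  by (simp add: mons_def)

lemma mons_add: "u \<in> mons n \<Longrightarrow> v \<in> mons n \<Longrightarrow> u + v \<in> mons n"
  using keys_add[of u v] by (auto simp: mons_def)

lemma keys_times_mons: "keys p \<subseteq> mons n \<Longrightarrow> keys q \<subseteq> mons n \<Longrightarrow> keys (p * q) \<subseteq> mons n"
  for p q :: "'k::field mpoly"
  using keys_mult[of p q] mons_add by blast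

lemma cring_T: "cring (T n :: 'k::field mpoly ring)"
proof (rule cringI)
  show "abelian_group (T n :: 'k mpoly ring)"
  proof (rule abelian_groupI)
    fix x :: "'k mpoly" assume "x \<in> carrier (T n)"
    then show "\<exists>y\<in>carrier (T n). y \<oplus>\<^bsub>T n\<^esub> x = \<zero>\<^bsub>T n\<^esub>"
      by (intro bexI[of _ "- x"]) (auto simp: in_keys_iff subset_iff)
  next
    fix x y :: "'k mpoly" assume "x \<in> carrier (T n)" "y \<in> carrier (T n)"
    then show "x \<oplus>\<^bsub>T n\<^esub> y \<in> carrier (T n)"
      using keys_add[of x y] by auto
  qed (auto simp: add_ac)
  show "comm_monoid (T n :: 'k mpoly ring)"
    by (rule comm_monoidI) (simp_all add: keys_times_mons mult_ac)
qed (auto simp: distrib_right)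

lemma keys_of_mon [simp]: "keys (of_mon u :: 'k::field mpoly) = {u}"
  by (simp add: of_mon_def)

lemma mons_cancel: "u + w \<in> mons n \<Longrightarrow> w \<in> mons n"
  by (auto simp: mons_def in_keys_iff lookup_add subset_iff)

lemma mpoly_eq_sum: "p = (\<Sum>v\<in>keys p. Poly_Mapping.single v (lookup p v))"
proof (rule poly_mapping_eqI)
  fix v
  have "(\<Sum>w\<in>keys p. lookup (Poly_Mapping.single w (lookup p w)) v)
        = (\<Sum>w\<in>keys p. if w = v then lookup p v else 0)"
    by (intro sum.cong) (auto simp: lookup_single when_def)
  also have "\<dots> = lookup p v"
    by (simp add: in_keys_iff)
  finally show "lookup p v = lookup (\<Sum>v\<in>keys p. Poly_Mapping.single v (lookup p v)) v"
    by (simp add: lookup_sum)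
qed

lemma mon_dvd_refl: "mon_dvd u u"
  unfolding mon_dvd_def by (intro exI[of _ 0]) simp

lemma mon_ideal_gen_eq:
  assumes "M \<subseteq> mons n"
  shows "(mon_ideal_gen n M :: 'k::field mpoly set)
         = {p. keys p \<subseteq> mons n \<and> (\<forall>v\<in>keys p. \<exists>u\<in>M. mon_dvd u v)}" (is "_ = ?J")
proof -
  interpret R: cring "T n :: 'k mpoly ring" by (rule cring_T)
  have sub: "(of_mon ` M :: 'k mpoly set) \<subseteq> carrier (T n)" using assms by auto
  have multJ: "p * q \<in> ?J" if "p \<in> ?J" "keys q \<subseteq> mons n" for p q :: "'k mpoly"
  proof -
    have "\<exists>u\<in>M. mon_dvd u v" if v: "v \<in> keys (p * q)" for v
    proof -
      obtain a b where ab: "a \<in> keys p" "v = a + b" using keys_mult[of p q] v by auto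
      then obtain u w where "u \<in> M" "a = u + w" using \<open>p \<in> ?J\<close> by (auto simp: mon_dvd_def)
      then show ?thesis using ab by (auto simp: mon_dvd_def add.assoc)
    qed
    then show ?thesis using keys_times_mons[of p n q] that by auto
  qed
  have addJ: "p + q \<in> ?J" if "p \<in> ?J" "q \<in> ?J" for p q :: "'k mpoly"
    using that keys_add[of p q] by blast
  have "ideal ?J (T n :: 'k mpoly ring)"
  proof (rule idealI)
    show "ring (T n :: 'k mpoly ring)" by (rule R.ring_axioms)
    show "subgroup ?J (add_monoid (T n :: 'k mpoly ring))"
    proof (rule group.subgroupI[OF R.a_group])
      fix p :: "'k mpoly" assume p: "p \<in> ?J"
      have "\<ominus>\<^bsub>T n\<^esub> p = - p"
        using p by (intro R.minus_equality) (auto simp: in_keys_iff subset_iff)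
      then have inv: "inv\<^bsub>add_monoid (T n)\<^esub> p = - p"
        unfolding a_inv_def .
      show "inv\<^bsub>add_monoid (T n)\<^esub> p \<in> ?J"
        unfolding inv mem_Collect_eq uminus_keys using p by blast
    next
      have "(0 :: 'k mpoly) \<in> ?J" by simp
      then show "?J \<noteq> {}" by blast
    next
      show "?J \<subseteq> carrier (add_monoid (T n))" by auto
    next
      fix p q :: "'k mpoly" assume "p \<in> ?J" "q \<in> ?J"
      from addJ[OF this] show "p \<otimes>\<^bsub>add_monoid (T n)\<^esub> q \<in> ?J" by (simp only: T_simps monoid.simps)
    qed
    show "\<And>a x. a \<in> ?J \<Longrightarrow> x \<in> carrier (T n) \<Longrightarrow> x \<otimes>\<^bsub>T n\<^esub> a \<in> ?J"
      using multJ by (simp add: mult.commute)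
    show "\<And>a x. a \<in> ?J \<Longrightarrow> x \<in> carrier (T n) \<Longrightarrow> a \<otimes>\<^bsub>T n\<^esub> x \<in> ?J"
      using multJ by simp
  qed
  moreover have "of_mon ` M \<subseteq> ?J"
  proof
    fix p :: "'k mpoly" assume "p \<in> of_mon ` M"
    then obtain u where "u \<in> M" "p = of_mon u" by blast
    then show "p \<in> ?J" using assms mon_dvd_refl[of u] by auto
  qed
  ultimately have le: "mon_ideal_gen n M \<subseteq> ?J"
    unfolding mon_ideal_gen_def by (rule R.genideal_minimal)
  interpret I: ideal "mon_ideal_gen n M" "T n :: 'k mpoly ring"
    unfolding mon_ideal_gen_def by (rule R.genideal_ideal[OF sub])
  have "p \<in> mon_ideal_gen n M" if p: "p \<in> ?J" for p :: "'k mpoly"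
  proof -
    have summand: "Poly_Mapping.single v (lookup p v) \<in> mon_ideal_gen n M" if v: "v \<in> keys p" for v
    proof -
      obtain u w where uw: "u \<in> M" "v = u + w" using p v by (auto simp: mon_dvd_def)
      then have w: "w \<in> mons n" using p v mons_cancel by blast
      have "(of_mon u :: 'k mpoly) \<in> mon_ideal_gen n M"
        unfolding mon_ideal_gen_def using R.genideal_self[OF sub] uw by blast
      then have "of_mon u \<otimes>\<^bsub>T n\<^esub> Poly_Mapping.single w (lookup p v) \<in> mon_ideal_gen n M"
        by (rule I.I_r_closed) (use w in auto)
      then show ?thesis using uw by (simp add: of_mon_def mult_single)
    qed
    have "(\<Sum>v\<in>A. Poly_Mapping.single v (lookup p v)) \<in> mon_ideal_gen n M"
      if "A \<subseteq> keys p" for A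
      using finite_subset[OF that finite_keys] that
    proof (induction A rule: finite_induct)
      case empty
      show ?case using I.zero_closed by simp
    next
      case (insert v A)
      then show ?case using I.a_closed[of "Poly_Mapping.single v (lookup p v)"] summand by simp
    qed
    from this[OF order_refl] show ?thesis by (subst mpoly_eq_sum)
  qed
  then show ?thesis using le by blast
qed

lemma of_mon_in_gen:
  assumes "M \<subseteq> mons n" "v \<in> mons n"
  shows "(of_mon v :: 'k::field mpoly) \<in> mon_ideal_gen n M \<longleftrightarrow> (\<exists>u\<in>M. mon_dvd u v)"
  using assms by (simp add: mon_ideal_gen_eq)

lemma mon_dvd_trans: "mon_dvd u v \<Longrightarrow> mon_dvd v w \<Longrightarrow> mon_dvd u w"
  by (auto simp: mon_dvd_def add.assoc)

lemma mon_dvd_lookup: "mon_dvd u v \<Longrightarrow> lookup u i \<le> lookup v i"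
  by (auto simp: mon_dvd_def lookup_add)

lemma mon_dvd_antisym: "mon_dvd u v \<Longrightarrow> mon_dvd v u \<Longrightarrow> u = v"
  by (intro poly_mapping_eqI) (meson mon_dvd_lookup le_antisym)

lemma mon_dvd_mdeg:
  assumes "mon_dvd u v" "u \<noteq> v"
  shows "mdeg u < mdeg v"
proof -
  have sub: "keys u \<subseteq> keys v"
  proof
    fix i assume "i \<in> keys u"
    then show "i \<in> keys v" using mon_dvd_lookup[OF assms(1), of i] by (simp add: in_keys_iff)
  qed
  obtain i where "lookup u i \<noteq> lookup v i" using assms(2) by (meson poly_mapping_eqI)
  then have i: "lookup u i < lookup v i" using mon_dvd_lookup[OF assms(1), of i] by simp
  have "mdeg u = (\<Sum>i\<in>keys v. lookup u i)"
    unfolding mdeg_def using sub by (intro sum.mono_neutral_left) (auto simp: in_keys_iff)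
  also have "\<dots> < (\<Sum>i\<in>keys v. lookup v i)"
  proof (rule sum_strict_mono_ex1)
    show "\<exists>i\<in>keys v. lookup u i < lookup v i"
      using i by (intro bexI[of _ i]) (auto simp: in_keys_iff)
  qed (use mon_dvd_lookup[OF assms(1)] in auto)
  finally show ?thesis by (simp add: mdeg_def)
qed

definition dvd_minimal :: "nat \<Rightarrow> 'k::field mpoly set \<Rightarrow> mon set" where
  "dvd_minimal n I =
     {u \<in> mons n. of_mon u \<in> I \<and> (\<forall>v\<in>mons n. of_mon v \<in> I \<longrightarrow> mon_dvd v u \<longrightarrow> v = u)}"

lemma dvd_minimal_below:
  assumes "u \<in> mons n" "of_mon u \<in> I"
  shows "\<exists>v\<in>dvd_minimal n I. mon_dvd v u"
  using assms
proof (induction "mdeg u" arbitrary: u rule: less_induct)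
  case less
  show ?case
  proof (cases "u \<in> dvd_minimal n I")
    case True
    then show ?thesis using mon_dvd_refl by blast
  next
    case False
    then obtain v where v: "v \<in> mons n" "of_mon v \<in> I" "mon_dvd v u" "v \<noteq> u"
      using less.prems by (auto simp: dvd_minimal_def)
    with less.hyps[OF mon_dvd_mdeg] show ?thesis using mon_dvd_trans by blast
  qed
qed

lemma dvd_minimal_subset_gens:
  assumes "M \<subseteq> mons n" "(I :: 'k::field mpoly set) = mon_ideal_gen n M"
  shows "dvd_minimal n I \<subseteq> M"
proof
  fix u assume u: "u \<in> dvd_minimal n I"
  then obtain v where v: "v \<in> M" "mon_dvd v u"
    using assms of_mon_in_gen[of M n u] by (auto simp: dvd_minimal_def)
  then have "(of_mon v :: 'k mpoly) \<in> I" using assms of_mon_in_gen[of M n v] mon_dvd_refl by blast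
  then show "u \<in> M" using u v assms(1) by (auto simp: dvd_minimal_def)
qed

lemma dvd_minimal_gens:
  assumes "monomial_ideal n (I :: 'k::field mpoly set)"
  shows "mon_ideal_gen n (dvd_minimal n I) = I"
proof -
  obtain M where M: "M \<subseteq> mons n" "I = mon_ideal_gen n M"
    using assms by (auto simp: monomial_ideal_def)
  have D: "dvd_minimal n I \<subseteq> mons n" by (auto simp: dvd_minimal_def)
  have "(\<exists>u\<in>dvd_minimal n I. mon_dvd u v) \<longleftrightarrow> (\<exists>u\<in>M. mon_dvd u v)" for v
  proof
    assume "\<exists>u\<in>M. mon_dvd u v"
    then obtain u where u: "u \<in> M" "mon_dvd u v" by blast
    then have "(of_mon u :: 'k mpoly) \<in> I" using M of_mon_in_gen[of M n u] mon_dvd_refl by blast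
    then show "\<exists>u\<in>dvd_minimal n I. mon_dvd u v"
      using dvd_minimal_below[of u n I] u M mon_dvd_trans by blast
  qed (use dvd_minimal_subset_gens[OF M] in blast)
  then show ?thesis using mon_ideal_gen_eq[OF D, where 'k='k] mon_ideal_gen_eq[OF M(1), where 'k='k] M(2)
    by simp
qed

lemma is_min_mon_gens_iff:
  assumes "monomial_ideal n (I :: 'k::field mpoly set)"
  shows "is_min_mon_gens n I M \<longleftrightarrow> M = dvd_minimal n I"
proof
  assume M: "is_min_mon_gens n I M"
  then have "M \<subseteq> mons n" "I = mon_ideal_gen n M"
    unfolding is_min_mon_gens_def by blast+
  then have "dvd_minimal n I \<subseteq> M"
    by (rule dvd_minimal_subset_gens)
  moreover have "\<not> dvd_minimal n I \<subset> M"
    using M dvd_minimal_gens[OF assms] unfolding is_min_mon_gens_def by blast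
  ultimately show "M = dvd_minimal n I"
    by blast
next
  assume M: "M = dvd_minimal n I"
  have D: "dvd_minimal n I \<subseteq> mons n" by (auto simp: dvd_minimal_def)
  show "is_min_mon_gens n I M"
    unfolding is_min_mon_gens_def M
  proof (intro conjI allI impI notI)
    fix M' assume M': "M' \<subset> dvd_minimal n I" "mon_ideal_gen n M' = I"
    then have "M' \<subseteq> mons n" using D by blast
    from dvd_minimal_subset_gens[OF this M'(2)[symmetric]] show False using M'(1) by blast
  next
    show "I = mon_ideal_gen n (dvd_minimal n I)" by (rule dvd_minimal_gens[OF assms, symmetric])
  qed (rule D)
qed

lemma ex1_min_mon_gens:
  "monomial_ideal n (I :: 'k::field mpoly set) \<Longrightarrow> \<exists>!M. is_min_mon_gens n I M"
  by (simp add: is_min_mon_gens_iff)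

lemma G_eq_dvd_minimal:
  "monomial_ideal n (I :: 'k::field mpoly set) \<Longrightarrow> G n I = dvd_minimal n I"
  by (simp add: G_def is_min_mon_gens_iff)

end

theory Submission
  imports Defs "HOL.Topological_Spaces"
begin

text \<open>
  The theorem reduces to a condition on positions in sorted index lists. Let
  \<open>i\<^sub>0 \<le> i\<^sub>1 \<le> \<dots>\<close> be the indices of the variables of \<open>u\<close>, each repeated according to its exponent, and
  let the block of \<open>i\<close> in \<open>u\<close> be the set of positions \<open>r\<close> with \<open>i\<^sub>r = i\<close>. Its size is the exponent of
  \<open>x\<^sub>i\<close>. The variable
  \<open>x\<^bsub>r n + i\<^esub>\<close> with \<open>1 \<le> i \<le> n\<close> is thought of as lying on level \<open>r\<close> above \<open>x\<^sub>i\<close>. Then \<open>\<sigma>\<^sup>n(u)\<close> and \<open>u\<^sup>p\<close>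
  are squarefree: above \<open>x\<^sub>i\<close>, the first occupies the levels in the block of \<open>i\<close>, and the second
  the levels below the exponent of \<open>x\<^sub>i\<close> (\<open>sigma_funpow_eq_squarefree_mon\<close>,
  \<open>polarization_eq_squarefree_mon\<close>).

  A permutation preserving residues modulo \<open>n\<close> permutes the levels above each \<open>x\<^sub>i\<close> separately. So
  \<open>I\<close> is smoothly spreadable iff, for each \<open>i\<close>, one permutation of the levels maps the blocks of \<open>i\<close>
  in all minimal generators onto initial segments. Initial segments are nested, so this forces a
  block of at most the size of another to be contained in it; conversely, a family of finite sets
  with that property can be straightened by one permutation
  (\<open>ex_bij_betw_initial_segments\<close>). This gives the criterion
  \<open>smoothly_spreadable_iff_block_chains\<close>, in which neither the degree of the ideal nor the ring
  isomorphism occurs any more.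

  The criterion passes to subsets of generators, which is part (2). For part (1), a new
  generator \<open>x\<^sub>j\<^sup>e\<close> adds the single set \<open>{0,\<dots>,e-1}\<close> to the family for \<open>j\<close>. A nonempty block of \<open>j\<close> in \<open>u\<close>
  lies below the degree of the part of \<open>u\<close> in \<open>x\<^sub>1, \<dots>, x\<^sub>j\<close>, which is at most \<open>e\<close> by hypothesis, so the
  new set contains all the others (\<open>block_chains_Un_xpows\<close>).
\<close>

section \<open>Renaming variables\<close>

lemma map_key_sum:
  "inj f \<Longrightarrow> Poly_Mapping.map_key f (\<Sum>x\<in>A. g x) = (\<Sum>x\<in>A. Poly_Mapping.map_key f (g x))"
  by (induction A rule: infinite_finite_induct) (simp_all add: map_key_plus map_key_zero)

text \<open>
  An additive bijection of the exponents is compatible with the convolution product. Both sides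
  are biadditive, so it suffices to compare them on single terms.
\<close>
lemma map_key_times:
  fixes p q :: "'a::monoid_add \<Rightarrow>\<^sub>0 'b::semiring_0" and f :: "'c::monoid_add \<Rightarrow> 'a"
  assumes f: "bij f" and add: "\<And>u v. f (u + v) = f u + f v"
  shows "Poly_Mapping.map_key f (p * q) = Poly_Mapping.map_key f p * Poly_Mapping.map_key f q"
proof -
  have inj: "inj f" using f by (rule bij_is_inj)
  have single: "Poly_Mapping.map_key f (Poly_Mapping.single u a * Poly_Mapping.single v b)
      = Poly_Mapping.map_key f (Poly_Mapping.single u a) * Poly_Mapping.map_key f (Poly_Mapping.single v b)"
    for u v and a b :: 'b
  proof -
    obtain u' v' where uv: "u = f u'" "v = f v'"
      using bij_is_surj[OF f] by (metis surjD)
    show ?thesis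
      unfolding uv mult_single add[symmetric] by (simp only: map_key_single[OF inj] mult_single)
  qed
  let ?s = "\<lambda>p v. Poly_Mapping.single v (lookup p v)"
  have "Poly_Mapping.map_key f ((\<Sum>u\<in>keys p. ?s p u) * (\<Sum>v\<in>keys q. ?s q v))
      = Poly_Mapping.map_key f (\<Sum>u\<in>keys p. ?s p u) * Poly_Mapping.map_key f (\<Sum>v\<in>keys q. ?s q v)"
    by (simp only: sum_product map_key_sum[OF inj] single)
  then show ?thesis
    by (simp only: mpoly_eq_sum[symmetric])
qed

text \<open>
  \<open>map_key\<close> pulls back along a map, so a renaming that sends \<open>x\<^sub>i\<close> to \<open>x\<^bsub>\<tau> i\<^esub>\<close> pulls back along the
  inverse of \<open>\<tau>\<close>. The inverse is written \<open>inv_into UNIV\<close> to keep it apart from inversion in a group.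
\<close>
definition rename :: "(nat \<Rightarrow> nat) \<Rightarrow> mon \<Rightarrow> mon" where
  "rename \<tau> = Poly_Mapping.map_key (inv_into UNIV \<tau>)"

definition rename_vars :: "(nat \<Rightarrow> nat) \<Rightarrow> 'k::field mpoly \<Rightarrow> 'k mpoly" where
  "rename_vars \<tau> = Poly_Mapping.map_key (rename (inv_into UNIV \<tau>))"

lemma inj_inv_if_bij: "bij \<tau> \<Longrightarrow> inj (inv_into UNIV \<tau>)"
  by (simp add: bij_imp_bij_inv bij_is_inj)

lemma rename_add: "bij \<tau> \<Longrightarrow> rename \<tau> (u + v) = rename \<tau> u + rename \<tau> v"
  by (simp add: rename_def map_key_plus inj_inv_if_bij)

lemma rename_xpow: "bij \<tau> \<Longrightarrow> rename \<tau> (xpow i a) = xpow (\<tau> i) a"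
  using map_key_single[OF inj_inv_if_bij, of \<tau> "\<tau> i" a]
  by (simp add: rename_def xpow_def bij_is_inj)

lemma rename_inverse:
  assumes "bij \<tau>"
  shows "rename (inv_into UNIV \<tau>) (rename \<tau> u) = u"
proof -
  have "rename (inv_into UNIV \<tau>) (rename \<tau> u)
      = Poly_Mapping.map_key \<tau> (Poly_Mapping.map_key (inv_into UNIV \<tau>) u)"
    by (simp only: rename_def inv_inv_eq[OF assms])
  also have "\<dots> = Poly_Mapping.map_key (inv_into UNIV \<tau> \<circ> \<tau>) u"
    by (rule map_key_compose[OF bij_is_inj[OF assms] inj_inv_if_bij[OF assms]])
  also have "inv_into UNIV \<tau> \<circ> \<tau> = (\<lambda>x. x)"
    using inv_f_f[OF bij_is_inj[OF assms]] by (simp only: fun_eq_iff comp_apply simp_thms)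
  finally show ?thesis by (simp only: map_key_id)
qed

lemma rename_inverse':
  assumes "bij \<tau>"
  shows "rename \<tau> (rename (inv_into UNIV \<tau>) u) = u"
  using rename_inverse[OF bij_imp_bij_inv[OF assms], of u] by (simp only: inv_inv_eq[OF assms])

lemma bij_rename: "bij \<tau> \<Longrightarrow> bij (rename \<tau>)"
  by (rule o_bij[of "rename (inv_into UNIV \<tau>)"]) (simp_all add: fun_eq_iff rename_inverse rename_inverse')

lemma rename_mons:
  assumes "\<tau> permutes {1..m}" "u \<in> mons m"
  shows "rename \<tau> u \<in> mons m"
proof -
  have "keys (rename \<tau> u) = inv_into UNIV \<tau> -` keys u"
    by (simp add: rename_def keys_map_key inj_inv_if_bij permutes_bij[OF assms(1)])
  moreover have "inv_into UNIV \<tau> -` {1..m} = {1..m}"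
    using permutes_in_image[OF permutes_inv[OF assms(1)]] by blast
  ultimately show ?thesis using assms(2) unfolding mons_def by blast
qed

lemma inj_rename_inv: "bij \<tau> \<Longrightarrow> inj (rename (inv_into UNIV \<tau>))"
  by (intro bij_is_inj bij_rename bij_imp_bij_inv)

lemma rename_vars_single:
  "bij \<tau> \<Longrightarrow> rename_vars \<tau> (Poly_Mapping.single u c) = Poly_Mapping.single (rename \<tau> u) c"
  using map_key_single[OF inj_rename_inv, of \<tau> "rename \<tau> u" c]
  by (simp only: rename_vars_def rename_inverse)

lemma rename_vars_inverse:
  assumes "bij \<tau>"
  shows "rename_vars (inv_into UNIV \<tau>) (rename_vars \<tau> p) = p"
proof -
  have "rename_vars (inv_into UNIV \<tau>) (rename_vars \<tau> p)
      = Poly_Mapping.map_key (rename \<tau>) (Poly_Mapping.map_key (rename (inv_into UNIV \<tau>)) p)"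
    by (simp only: rename_vars_def inv_inv_eq[OF assms])
  also have "\<dots> = Poly_Mapping.map_key (rename (inv_into UNIV \<tau>) \<circ> rename \<tau>) p"
    by (rule map_key_compose[OF bij_is_inj[OF bij_rename[OF assms]] inj_rename_inv[OF assms]])
  also have "rename (inv_into UNIV \<tau>) \<circ> rename \<tau> = (\<lambda>x. x)"
    using rename_inverse[OF assms] by (simp only: fun_eq_iff comp_apply simp_thms)
  finally show ?thesis by (simp only: map_key_id)
qed

lemma rename_vars_inverse':
  assumes "bij \<tau>"
  shows "rename_vars \<tau> (rename_vars (inv_into UNIV \<tau>) p) = p"
  using rename_vars_inverse[OF bij_imp_bij_inv[OF assms], of p] by (simp only: inv_inv_eq[OF assms])

lemma rename_vars_carrier:
  assumes "\<tau> permutes {1..m}" "keys (p :: 'k::field mpoly) \<subseteq> mons m"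
  shows "keys (rename_vars \<tau> p) \<subseteq> mons m"
proof
  have b: "bij \<tau>" using assms(1) by (rule permutes_bij)
  fix v assume "v \<in> keys (rename_vars \<tau> p)"
  then have "rename (inv_into UNIV \<tau>) v \<in> mons m"
    using assms(2) by (auto simp: rename_vars_def keys_map_key inj_rename_inv b)
  then show "v \<in> mons m"
    using rename_mons[OF assms(1), of "rename (inv_into UNIV \<tau>) v"] by (simp add: rename_inverse' b)
qed

lemma K_algebra_iso_rename_vars:
  assumes \<tau>: "\<tau> permutes {1..m}"
  shows "K_algebra_iso m m (rename_vars \<tau> :: 'k::field mpoly \<Rightarrow> 'k mpoly)"
proof -
  have b: "bij \<tau>" using \<tau> by (rule permutes_bij)
  have zero: "rename \<tau> 0 = 0"
    by (simp add: rename_def map_key_zero inj_inv_if_bij b)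
  have const: "rename_vars \<tau> (const c) = const c" for c :: 'k
    by (simp add: const_def rename_vars_single b zero)
  have "rename_vars \<tau> \<in> ring_hom (T m :: 'k mpoly ring) (T m)"
  proof (rule ring_hom_memI)
    show "rename_vars \<tau> \<one>\<^bsub>T m\<^esub> = (\<one>\<^bsub>T m\<^esub> :: 'k mpoly)"
      using const[of 1] by (simp add: const_def)
  qed (use rename_vars_carrier[OF \<tau>] in
       \<open>auto simp: rename_vars_def map_key_plus inj_rename_inv b map_key_times bij_rename bij_imp_bij_inv rename_add\<close>)
  moreover have "bij_betw (rename_vars \<tau>) (carrier (T m :: 'k mpoly ring)) (carrier (T m))"
  proof (rule bij_betw_byWitness[where f' = "rename_vars (inv_into UNIV \<tau>)"])
    show "\<forall>p\<in>carrier (T m). rename_vars (inv_into UNIV \<tau>) (rename_vars \<tau> p) = p"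
      by (simp add: rename_vars_inverse b)
    show "\<forall>p\<in>carrier (T m). rename_vars \<tau> (rename_vars (inv_into UNIV \<tau>) p) = p"
      by (simp add: rename_vars_inverse' b)
  qed (use rename_vars_carrier[OF \<tau>] rename_vars_carrier[OF permutes_inv[OF \<tau>]] in auto)
  ultimately show ?thesis
    by (simp add: K_algebra_iso_def ring_iso_def const)
qed

section \<open>Squarefree monomials\<close>

definition squarefree_mon :: "nat set \<Rightarrow> mon" where
  "squarefree_mon A = (\<Sum>i\<in>A. xpow i 1)"

lemma lookup_squarefree_mon: "finite A \<Longrightarrow> lookup (squarefree_mon A) i = (if i \<in> A then 1 else 0)"
  by (simp add: squarefree_mon_def lookup_sum xpow_def lookup_single when_def)

lemma keys_squarefree_mon: "finite A \<Longrightarrow> keys (squarefree_mon A) = A"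
  by (auto simp: in_keys_iff lookup_squarefree_mon split: if_splits)

lemma squarefree_mon_inj: "finite A \<Longrightarrow> finite B \<Longrightarrow> squarefree_mon A = squarefree_mon B \<Longrightarrow> A = B"
  by (metis keys_squarefree_mon)

lemma squarefree_mon_mons: "A \<subseteq> {1..m} \<Longrightarrow> squarefree_mon A \<in> mons m"
  using finite_subset[of A "{1..m}"] by (simp add: mons_def keys_squarefree_mon)

text \<open>
  A homomorphism is determined on squarefree monomials by its values on the variables. The
  injectivity of \<open>\<tau>\<close> keeps the image squarefree.
\<close>
lemma hom_of_mon_squarefree_mon:
  fixes \<Phi> :: "'k::field mpoly \<Rightarrow> 'k mpoly"
  assumes \<Phi>: "\<Phi> \<in> ring_hom (T m) (T m)"
    and var: "\<forall>i\<in>{1..m}. \<Phi> (of_mon (xpow i 1)) = of_mon (xpow (\<tau> i) 1)"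
    and inj: "inj_on \<tau> {1..m}" and A: "A \<subseteq> {1..m}"
  shows "\<Phi> (of_mon (squarefree_mon A)) = of_mon (squarefree_mon (\<tau> ` A))"
  using finite_subset[OF A finite_atLeastAtMost] A
proof (induction A rule: finite_induct)
  case empty
  then show ?case using ring_hom_one[OF \<Phi>] by (simp add: squarefree_mon_def of_mon_def)
next
  case (insert i A)
  have fresh: "\<tau> i \<notin> \<tau> ` A" using insert.prems insert.hyps inj by (auto dest: inj_onD)
  have split: "(of_mon (squarefree_mon (insert x B)) :: 'k mpoly) = of_mon (xpow x 1) * of_mon (squarefree_mon B)"
    if "finite B" "x \<notin> B" for x B
    using that by (simp add: squarefree_mon_def of_mon_def mult_single)
  have "\<Phi> (of_mon (xpow i 1) * of_mon (squarefree_mon A)) = \<Phi> (of_mon (xpow i 1)) * \<Phi> (of_mon (squarefree_mon A))"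
    using ring_hom_mult[OF \<Phi>, of "of_mon (xpow i 1)" "of_mon (squarefree_mon A)"] insert.prems
      squarefree_mon_mons[of A m] squarefree_mon_mons[of "{i}" m] by (simp add: squarefree_mon_def)
  then show ?case using insert var fresh by (simp add: split)
qed


section \<open>Finiteness of minimal generating sets\<close>

lemma mon_dvd_iff: "mon_dvd u v \<longleftrightarrow> (\<forall>i. lookup u i \<le> lookup v i)"
proof
  assume "\<forall>i. lookup u i \<le> lookup v i"
  then have "v = u + (v - u)"
    by (intro poly_mapping_eqI) (simp add: lookup_add lookup_minus)
  then show "mon_dvd u v" unfolding mon_dvd_def by blast
qed (simp add: mon_dvd_lookup)

text \<open>
  The combinatorial core of Dickson's lemma. Every sequence of natural numbers has a monotone
  subsequence, and a decreasing one is eventually constant; the coordinates are treated one after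
  the other.
\<close>
lemma ex_incseq_subseq:
  fixes s :: "nat \<Rightarrow> 'a \<Rightarrow> nat"
  assumes "finite A"
  shows "\<exists>f :: nat \<Rightarrow> nat. strict_mono f \<and> (\<forall>i\<in>A. incseq (\<lambda>m. s (f m) i))"
  using assms
proof (induction A rule: finite_induct)
  case empty
  show ?case by (intro exI[of _ id]) (simp add: strict_mono_def)
next
  case (insert i A)
  then obtain f :: "nat \<Rightarrow> nat" where f: "strict_mono f" "\<forall>i\<in>A. incseq (\<lambda>m. s (f m) i)"
    by blast
  have "\<exists>g :: nat \<Rightarrow> nat. strict_mono g \<and> incseq (\<lambda>m. s (f (g m)) i)"
  proof -
    obtain g :: "nat \<Rightarrow> nat" where g: "strict_mono g" "monoseq (\<lambda>m. s (f (g m)) i)"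
      using seq_monosub[of "\<lambda>m. s (f m) i"] by auto
    show ?thesis
    proof (cases "incseq (\<lambda>m. s (f (g m)) i)")
      case True
      with g show ?thesis by blast
    next
      case False
      with g have dec: "decseq (\<lambda>m. s (f (g m)) i)" by (simp add: monoseq_iff)
      \<comment> \<open>The decreasing sequence attains its minimum at \<open>N\<close> and is constant from there on.\<close>
      define N where "N = arg_min (\<lambda>m. s (f (g m)) i) (\<lambda>_. True)"
      have "s (f (g N)) i \<le> s (f (g m)) i" for m
        unfolding N_def by (rule arg_min_nat_le) simp
      then have "s (f (g (m + N))) i = s (f (g N)) i" for m
        using decseqD[OF dec, of N "m + N"] by (simp add: le_antisym)
      then have "incseq (\<lambda>m. s (f (g (m + N))) i)" by (simp add: incseq_def)
      moreover have "strict_mono (\<lambda>m. g (m + N))" using g(1) by (simp add: strict_mono_def)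
      ultimately show ?thesis by (intro exI[of _ "\<lambda>m. g (m + N)"]) simp
    qed
  qed
  then obtain g :: "nat \<Rightarrow> nat" where g: "strict_mono g" "incseq (\<lambda>m. s (f (g m)) i)" by blast
  have "incseq (\<lambda>m. s (f (g m)) i')" if "i' \<in> A" for i'
    using f(2) that g(1) by (auto simp: incseq_def strict_mono_less_eq)
  with f g show ?case
    by (intro exI[of _ "f \<circ> g"]) (auto simp: strict_mono_def)
qed

text \<open>
  An infinite set of minimal generators would contain, by \<open>ex_incseq_subseq\<close>, two distinct monomials
  one of which divides the other, against minimality. Finiteness is what makes the
  maxima over generators, in the degree of an ideal and in the hypothesis of part (1), genuine
  upper bounds.
\<close>
lemma finite_G:
  assumes "monomial_ideal n (I :: 'k::field mpoly set)"
  shows "finite (G n I)"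
proof (rule ccontr)
  assume inf: "infinite (G n I)"
  obtain s :: "nat \<Rightarrow> mon" where s: "inj s" "range s \<subseteq> G n I"
    using infinite_countable_subset[OF inf] by blast
  obtain f :: "nat \<Rightarrow> nat" where f: "strict_mono f" "\<forall>i\<in>{1..n}. incseq (\<lambda>m. lookup (s (f m)) i)"
    using ex_incseq_subseq[of "{1..n}" "\<lambda>m. lookup (s m)"] by auto
  have G: "s m \<in> dvd_minimal n I" for m
    using s(2) by (auto simp: G_eq_dvd_minimal[OF assms])
  have "lookup (s (f 0)) i \<le> lookup (s (f 1)) i" for i
  proof (cases "i \<in> {1..n}")
    case True
    then show ?thesis using f(2) by (auto simp: incseq_def)
  next
    case False
    then have "i \<notin> keys (s (f 0))" using G[of "f 0"] unfolding dvd_minimal_def mons_def by blast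
    then show ?thesis by (simp add: in_keys_iff)
  qed
  then have "mon_dvd (s (f 0)) (s (f 1))" by (simp add: mon_dvd_iff)
  then have "s (f 0) = s (f 1)"
    using G[of "f 0"] G[of "f 1"] by (auto simp: dvd_minimal_def)
  then have "f 0 = f 1" using s(1) by (auto dest: injD)
  then show False using f(1) by (auto simp: strict_mono_eq)
qed

lemma mdeg_le_ideal_deg:
  assumes "monomial_ideal n (I :: 'k::field mpoly set)" "u \<in> G n I"
  shows "mdeg u \<le> ideal_deg n I"
  unfolding ideal_deg_def using assms finite_G by (intro Max_ge) auto

section \<open>Monomials as sorted index lists\<close>

lemma count_list_replicate: "count_list (replicate m x) y = (if x = y then m else 0)"
  by (induction m) auto

lemma count_concat_replicate:
  "distinct xs \<Longrightarrow>
   count_list (concat (map (\<lambda>i. replicate (c i) i) xs)) i = (if i \<in> set xs then c i else 0)"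
  by (induction xs) (auto simp: count_list_replicate)

lemma count_mon_indices: "count_list (mon_indices u) i = lookup u i"
  by (simp add: mon_indices_def count_concat_replicate in_keys_iff)

lemma sorted_concat_replicate:
  "sorted xs \<Longrightarrow> sorted (concat (map (\<lambda>i. replicate (c i) i) xs))"
  by (induction xs) (auto simp: sorted_append)

lemma sorted_mon_indices: "sorted (mon_indices u)"
  by (simp add: mon_indices_def sorted_concat_replicate)

lemma length_mon_indices: "length (mon_indices u) = mdeg u"
  by (simp add: mon_indices_def length_concat comp_def mdeg_def sum_list_distinct_conv_sum_set)

lemma lookup_xpow: "lookup (xpow j a) i = (if i = j then a else 0)"
  by (simp add: xpow_def lookup_single when_def)

definition mon_of_list :: "nat list \<Rightarrow> mon" where
  "mon_of_list xs = (\<Sum>r<length xs. xpow (xs ! r) 1)"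

lemma lookup_mon_of_list: "lookup (mon_of_list xs) i = count_list xs i"
proof -
  have "lookup (mon_of_list xs) i = (\<Sum>r<length xs. if xs ! r = i then 1 else 0)"
    by (simp add: mon_of_list_def lookup_sum lookup_xpow eq_commute del: One_nat_def)
  also have "\<dots> = card {r. r < length xs \<and> xs ! r = i}"
    by (subst sum.If_cases) (auto simp: lessThan_def Int_def)
  also have "\<dots> = count_list xs i"
    by (simp add: count_list_eq_length_filter length_filter_conv_card eq_commute)
  finally show ?thesis .
qed

lemma mon_of_list_mon_indices: "mon_of_list (mon_indices u) = u"
  by (intro poly_mapping_eqI) (simp add: lookup_mon_of_list count_mon_indices)

text \<open>
  A sorted list is determined by its multiset of entries, so every sorted list is the index list of
  its monomial. This allows the operator \<open>sigma\<close> to be iterated on lists.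
\<close>
lemma mon_indices_mon_of_list:
  assumes "sorted xs"
  shows "mon_indices (mon_of_list xs) = xs"
proof -
  have "mset (mon_indices (mon_of_list xs)) = mset xs"
    by (intro multiset_eqI)
      (metis count_mset count_mon_indices lookup_mon_of_list)
  then show ?thesis
    using properties_for_sort[OF _ sorted_mon_indices] sorted_sort_id[OF assms] by metis
qed

text \<open>
  Shifting position \<open>r\<close> by \<open>r\<close> keeps the list sorted, so the shifts of successive applications
  of \<open>sigma\<close> accumulate position by position.
\<close>
lemma sigma_funpow:
  "(sigma ^^ t) u = mon_of_list (map (\<lambda>r. mon_indices u ! r + r * t) [0..<mdeg u])"
proof (induction t)
  case 0
  have "map ((!) (mon_indices u)) [0..<mdeg u] = mon_indices u"
    using map_nth[of "mon_indices u"] by (simp add: length_mon_indices)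
  then show ?case by (simp add: mon_of_list_mon_indices)
next
  case (Suc t)
  let ?xs = "map (\<lambda>r. mon_indices u ! r + r * t) [0..<mdeg u]"
  have "sorted ?xs"
    unfolding sorted_iff_nth_mono
    using sorted_nth_mono[OF sorted_mon_indices, of _ _ u]
    by (auto simp: length_mon_indices intro!: add_mono)
  then have "mon_indices (mon_of_list ?xs) = ?xs" by (rule mon_indices_mon_of_list)
  then have "sigma (mon_of_list ?xs) = mon_of_list (map (\<lambda>r. mon_indices u ! r + r * Suc t) [0..<mdeg u])"
    by (auto simp: sigma_def mon_of_list_def add_ac intro!: sum.cong)
  then show ?case by (simp add: Suc.IH)
qed

section \<open>Blocks of equal indices\<close>

definition block :: "mon \<Rightarrow> nat \<Rightarrow> nat set" where
  "block u i = {r. r < mdeg u \<and> mon_indices u ! r = i}"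

lemma block_subset: "block u i \<subseteq> {..<mdeg u}"
  by (auto simp: block_def)

lemma finite_block: "finite (block u i)"
  using block_subset finite_subset by blast

lemma card_block: "card (block u i) = lookup u i"
proof -
  have "card (block u i) = count_list (mon_indices u) i"
    by (simp add: block_def count_list_eq_length_filter length_filter_conv_card eq_commute
        length_mon_indices)
  then show ?thesis by (simp add: count_mon_indices)
qed

lemma block_eq_empty: "lookup u i = 0 \<Longrightarrow> block u i = {}"
  using card_block[of u i] finite_block[of u i] by simp

lemma mdeg_xpow: "mdeg (xpow j a) = a"
  by (simp add: mdeg_def xpow_def)

lemma block_xpow: "block (xpow j a) j = {..<a}"
proof (rule card_subset_eq)
  show "block (xpow j a) j \<subseteq> {..<a}" using block_subset[of "xpow j a" j] by (simp add: mdeg_xpow)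
qed (simp_all add: card_block lookup_xpow)

lemma lookup_set_to_one: "lookup (set_to_one A u) i = (if i \<in> A then 0 else lookup u i)"
  by (auto simp: set_to_one_def lookup_sum lookup_xpow in_keys_iff)

lemma mdeg_eq_sum: "finite A \<Longrightarrow> keys u \<subseteq> A \<Longrightarrow> mdeg u = (\<Sum>i\<in>A. lookup u i)"
  unfolding mdeg_def by (intro sum.mono_neutral_left) (auto simp: in_keys_iff)

text \<open>
  As the index list is sorted, all positions up to one carrying \<open>i\<close> carry an index at most \<open>i\<close>. The
  number of positions with an index at most \<open>i\<close> is the degree of the part of \<open>u\<close> in \<open>x\<^sub>1, \<dots>, x\<^sub>i\<close>.
\<close>
lemma block_subset_mdeg_set_to_one:
  assumes u: "u \<in> mons n"
  shows "block u i \<subseteq> {..<mdeg (set_to_one {i + 1..n} u)}"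
proof
  fix r assume r: "r \<in> block u i"
  have keys_v: "keys (set_to_one {i + 1..n} u) \<subseteq> {..i}"
  proof
    fix i' assume "i' \<in> keys (set_to_one {i + 1..n} u)"
    then have "i' \<in> keys u" "i' \<notin> {i + 1..n}"
      by (auto simp: in_keys_iff lookup_set_to_one split: if_splits)
    then show "i' \<in> {..i}" using u by (auto simp: mons_def)
  qed
  have "{..r} \<subseteq> (\<Union>i'\<in>{..i}. block u i')"
    using r sorted_nth_mono[OF sorted_mon_indices, of _ r u]
    by (auto simp: block_def length_mon_indices)
  then have "card {..r} \<le> card (\<Union>i'\<in>{..i}. block u i')"
    by (intro card_mono) (auto simp: finite_block)
  also have "\<dots> \<le> (\<Sum>i'\<le>i. card (block u i'))"
    by (rule card_UN_le) simp
  also have "\<dots> = (\<Sum>i'\<le>i. lookup (set_to_one {i + 1..n} u) i')"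
    by (intro sum.cong) (auto simp: card_block lookup_set_to_one)
  also have "\<dots> = mdeg (set_to_one {i + 1..n} u)"
    using keys_v by (subst mdeg_eq_sum[of "{..i}"]) auto
  finally show "r \<in> {..<mdeg (set_to_one {i + 1..n} u)}" by simp
qed


section \<open>Variables arranged by residue class and level\<close>

text \<open>
  The representatives of the residue classes are \<open>1, \<dots>, n\<close> and not \<open>0, \<dots>, n - 1\<close>, as the variables
  are numbered from 1; hence the passage to predecessors before dividing with remainder.
\<close>
lemma cell_inj:
  fixes n i i' r r' :: nat
  assumes "r * n + i = r' * n + i'" "i \<in> {1..n}" "i' \<in> {1..n}"
  shows "r = r' \<and> i = i'"
proof -
  obtain a a' where a: "i = Suc a" "i' = Suc a'" "a < n" "a' < n"
    using assms(2,3) by (cases i; cases i') auto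
  then have eq: "r * n + a = r' * n + a'" using assms(1) by simp
  have "(r * n + a) div n = r" "(r' * n + a') div n = r'" using a by simp_all
  then show ?thesis using eq a by simp
qed

lemma cell_inj_on: "inj_on (\<lambda>(i, r). r * n + i) ({1..n} \<times> (UNIV :: nat set))"
proof (rule inj_onI)
  fix x y :: "nat \<times> nat"
  assume "x \<in> {1..n} \<times> UNIV" "y \<in> {1..n} \<times> UNIV"
    "(case x of (i, r) \<Rightarrow> r * n + i) = (case y of (i, r) \<Rightarrow> r * n + i)"
  then show "x = y"
    using cell_inj[of "snd x" n "fst x" "snd y" "fst y"] by (cases x; cases y) simp
qed

lemma cell_image:
  fixes n d :: nat
  shows "(\<lambda>(i, r). r * n + i) ` ({1..n} \<times> {..<d}) = {1..n * d}"
proof (intro equalityI subsetI)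
  fix x assume "x \<in> (\<lambda>(i, r). r * n + i) ` ({1..n} \<times> {..<d})"
  then obtain i r where x: "x = r * n + i" "1 \<le> i" "i \<le> n" "r < d" by auto
  then have "r * n + i \<le> Suc r * n" by simp
  also have "\<dots> \<le> d * n" using x(4) by (intro mult_le_mono1) simp
  finally show "x \<in> {1..n * d}" using x by (simp add: mult.commute)
next
  fix x assume x: "x \<in> {1..n * d}"
  then have n: "0 < n" by (cases n) auto
  let ?y = "x - 1"
  have "x = (?y div n) * n + Suc (?y mod n)" using x by simp
  moreover have "Suc (?y mod n) \<in> {1..n}" using n by (simp add: Suc_leI)
  moreover have "?y div n < d"
    using x by (intro less_mult_imp_div_less) (auto simp: mult.commute)
  ultimately show "x \<in> (\<lambda>(i, r). r * n + i) ` ({1..n} \<times> {..<d})"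
    by (intro image_eqI[of _ _ "(Suc (?y mod n), ?y div n)"]) auto
qed

text \<open>
  Both \<open>\<sigma>\<^sup>n(u)\<close> and \<open>u\<^sup>p\<close> are products over such sets of variables; \<open>B i\<close> is then the block of \<open>i\<close> or
  an initial segment of the levels.
\<close>
definition cells :: "nat \<Rightarrow> (nat \<Rightarrow> nat set) \<Rightarrow> nat set" where
  "cells n B = (\<lambda>(i, r). r * n + i) ` Sigma {1..n} B"

lemma cell_in_cells_iff:
  assumes "i \<in> {1..n}"
  shows "r * n + i \<in> cells n B \<longleftrightarrow> r \<in> B i"
proof
  assume "r * n + i \<in> cells n B"
  then obtain i' r' where "r * n + i = r' * n + i'" "i' \<in> {1..n}" "r' \<in> B i'"
    by (auto simp: cells_def)
  then show "r \<in> B i" using cell_inj[of r n i r' i'] assms by simp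
next
  assume "r \<in> B i"
  then show "r * n + i \<in> cells n B"
    unfolding cells_def using assms by (intro image_eqI[of _ _ "(i, r)"]) auto
qed

lemma finite_cells: "(\<And>i. finite (B i)) \<Longrightarrow> finite (cells n B)"
  by (simp add: cells_def)

lemma cells_subset: "(\<And>i. B i \<subseteq> {..<d}) \<Longrightarrow> cells n B \<subseteq> {1..n * d}"
  unfolding cell_image[symmetric] cells_def by (intro image_mono Sigma_mono) auto

lemma sum_cells: "(\<And>i. finite (B i)) \<Longrightarrow> (\<Sum>i=1..n. \<Sum>r\<in>B i. xpow (r * n + i) 1) = squarefree_mon (cells n B)"
proof -
  assume fin: "\<And>i. finite (B i)"
  have "inj_on (\<lambda>(i, r). r * n + i) (Sigma {1..n} B)"
    by (rule inj_on_subset[OF cell_inj_on]) auto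
  then have "squarefree_mon (cells n B) = (\<Sum>(i, r)\<in>Sigma {1..n} B. xpow (r * n + i) 1)"
    unfolding squarefree_mon_def cells_def by (subst sum.reindex) (auto simp: case_prod_unfold)
  also have "\<dots> = (\<Sum>i=1..n. \<Sum>r\<in>B i. xpow (r * n + i) 1)"
    by (rule sum.Sigma[symmetric]) (use fin in auto)
  finally show ?thesis by simp
qed

lemma polarization_eq_squarefree_mon: "polarization n u = squarefree_mon (cells n (\<lambda>i. {..<lookup u i}))"
  unfolding polarization_def by (rule sum_cells) simp

lemma sigma_funpow_eq_squarefree_mon:
  assumes u: "u \<in> mons n"
  shows "(sigma ^^ n) u = squarefree_mon (cells n (block u))"
proof -
  have idx: "mon_indices u ! r \<in> {1..n}" if "r < mdeg u" for r
  proof -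
    have "mon_indices u ! r \<in> set (mon_indices u)" using that by (simp add: length_mon_indices)
    also have "\<dots> \<subseteq> keys u" by (auto simp: mon_indices_def)
    finally show ?thesis using u by (auto simp: mons_def)
  qed
  have "(sigma ^^ n) u = (\<Sum>r<mdeg u. xpow (r * n + mon_indices u ! r) 1)"
    by (simp add: sigma_funpow mon_of_list_def add.commute)
  also have "\<dots> = (\<Sum>i\<in>{1..n}. \<Sum>r\<in>{r \<in> {..<mdeg u}. mon_indices u ! r = i}. xpow (r * n + mon_indices u ! r) 1)"
    by (rule sum.group[symmetric]) (use idx in auto)
  also have "\<dots> = (\<Sum>i=1..n. \<Sum>r\<in>block u i. xpow (r * n + i) 1)"
    by (intro sum.cong) (auto simp: block_def)
  also have "\<dots> = squarefree_mon (cells n (block u))"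
    by (rule sum_cells) (rule finite_block)
  finally show ?thesis .
qed

section \<open>Chains of finite sets and permutations\<close>

text \<open>
  If \<open>F\<close> has members other than \<open>S\<close>, one of them contains all the others, so some \<open>x\<close> in \<open>S\<close> lies in
  no member of \<open>F\<close> except possibly \<open>S\<close> itself. This \<open>x\<close> is sent to the last place, and the rest of \<open>S\<close> is
  treated by induction.
\<close>
lemma ex_bij_betw_initial_segments:
  assumes "finite S" "F \<subseteq> Pow S" "\<And>X Y. X \<in> F \<Longrightarrow> Y \<in> F \<Longrightarrow> card X \<le> card Y \<Longrightarrow> X \<subseteq> Y"
  shows "\<exists>\<pi> :: 'a \<Rightarrow> nat. bij_betw \<pi> S {..<card S} \<and> (\<forall>X\<in>F. \<pi> ` X = {..<card X})"
  using assms
proof (induction S arbitrary: F rule: finite_psubset_induct)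
  case (psubset S)
  show ?case
  proof (cases "S = {}")
    case True
    then have "X = {}" if "X \<in> F" for X using psubset.prems(1) that by blast
    then have "\<forall>X\<in>F. (\<lambda>_. 0 :: nat) ` X = {..<card X}" by fastforce
    with True show ?thesis by (intro exI[of _ "\<lambda>_. 0"]) (simp add: bij_betw_def)
  next
    case False
    have fin: "finite (F - {S})"
      using psubset.prems(1) psubset.hyps by (meson finite_Diff finite_Pow_iff finite_subset)
    have "\<exists>x\<in>S. \<forall>X\<in>F - {S}. x \<notin> X"
    proof (cases "F - {S} = {}")
      case True
      with False show ?thesis by blast
    next
      case nonempty: False
      then obtain Y where Y: "Y \<in> F - {S}" "card Y = Max (card ` (F - {S}))"
        using fin by (metis (mono_tags) Max_in finite_imageI image_iff image_is_empty)
      then have "X \<subseteq> Y" if "X \<in> F - {S}" for X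
        using that fin psubset.prems(2) by auto
      moreover obtain x where "x \<in> S" "x \<notin> Y" using Y(1) psubset.prems(1) by blast
      ultimately show ?thesis by blast
    qed
    then obtain x where x: "x \<in> S" "\<And>X. X \<in> F - {S} \<Longrightarrow> x \<notin> X" by blast
    have "\<exists>\<pi> :: 'a \<Rightarrow> nat. bij_betw \<pi> (S - {x}) {..<card (S - {x})}
        \<and> (\<forall>X\<in>F - {S}. \<pi> ` X = {..<card X})"
    proof (rule psubset.IH)
      show "S - {x} \<subset> S" using x(1) by blast
      show "F - {S} \<subseteq> Pow (S - {x})" using x(2) psubset.prems(1) by blast
    qed (use psubset.prems(2) in blast)
    then obtain \<pi> :: "'a \<Rightarrow> nat" where \<pi>: "bij_betw \<pi> (S - {x}) {..<card (S - {x})}"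
      "\<And>X. X \<in> F - {S} \<Longrightarrow> \<pi> ` X = {..<card X}" by blast
    \<comment> \<open>The values of \<open>\<pi>\<close> are the numbers below \<open>card (S - {x})\<close>, so that number itself is the last place.\<close>
    let ?\<rho> = "\<pi>(x := card (S - {x}))"
    have "bij_betw ?\<rho> (S - {x}) {..<card (S - {x})}"
      using \<pi>(1) by (subst bij_betw_cong[of _ ?\<rho> \<pi>]) auto
    then have "bij_betw ?\<rho> (S - {x} \<union> {x}) ({..<card (S - {x})} \<union> {?\<rho> x})"
      by (intro notIn_Un_bij_betw) auto
    moreover have "S - {x} \<union> {x} = S" using x(1) by blast
    moreover have "{..<card (S - {x})} \<union> {?\<rho> x} = {..<card S}"
      using card.remove[OF psubset.hyps(1) x(1)] by auto
    ultimately have bij: "bij_betw ?\<rho> S {..<card S}" by simp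
    have "?\<rho> ` X = {..<card X}" if "X \<in> F" for X
    proof (cases "X = S")
      case True
      then show ?thesis using bij by (simp add: bij_betw_def)
    next
      case False
      with that have "X \<in> F - {S}" by blast
      with x(2) \<pi>(2)[of X] show ?thesis by (metis fun_upd_image)
    qed
    with bij show ?thesis by blast
  qed
qed

text \<open>
  Every \<open>x\<close> in \<open>{1..n * d}\<close> is uniquely \<open>r * n + i\<close> with \<open>i\<close> in \<open>{1..n}\<close> and \<open>r < d\<close>. Only the level \<open>r\<close> moves
  under \<open>\<tau>\<close>, so residues modulo \<open>n\<close> are kept.
\<close>
lemma ex_permutation_of_cells:
  fixes n d :: nat
  assumes \<pi>: "\<And>i. i \<in> {1..n} \<Longrightarrow> bij_betw (\<pi> i) {..<d} {..<d}"
  obtains \<tau> where "\<tau> permutes {1..n * d}"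
    "\<And>i r. i \<in> {1..n} \<Longrightarrow> r < d \<Longrightarrow> \<tau> (r * n + i) = \<pi> i r * n + i"
proof
  let ?c = "\<lambda>(i, r). r * n + i"
  define P where "P = {1..n} \<times> {..<d}"
  define g where "g = the_inv_into P ?c"
  define \<tau> where "\<tau> x = (if x \<in> {1..n * d} then \<pi> (fst (g x)) (snd (g x)) * n + fst (g x) else x)" for x
  have inj: "inj_on ?c P" unfolding P_def by (rule inj_on_subset[OF cell_inj_on]) auto
  show val: "\<tau> (r * n + i) = \<pi> i r * n + i" if "i \<in> {1..n}" "r < d" for i r
  proof -
    have ir: "(i, r) \<in> P" using that by (simp add: P_def)
    then have "r * n + i \<in> {1..n * d}" unfolding cell_image[symmetric] P_def[symmetric] by force
    moreover have "g (r * n + i) = (i, r)" using the_inv_into_f_f[OF inj ir] by (simp add: g_def)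
    ultimately show ?thesis by (simp add: \<tau>_def)
  qed
  have lt: "\<pi> i r < d" if "i \<in> {1..n}" "r < d" for i r
    using \<pi>[OF that(1)] that(2) by (auto simp: bij_betw_def)
  have "inj_on \<tau> {1..n * d}"
  proof (rule inj_onI)
    fix x y assume "x \<in> {1..n * d}" "y \<in> {1..n * d}" and eq: "\<tau> x = \<tau> y"
    then obtain i r i' r' where ir: "x = r * n + i" "i \<in> {1..n}" "r < d"
      "y = r' * n + i'" "i' \<in> {1..n}" "r' < d"
      unfolding cell_image[symmetric] by auto
    then have "\<pi> i r * n + i = \<pi> i' r' * n + i'" using eq val by simp
    then have "\<pi> i r = \<pi> i' r' \<and> i = i'" using cell_inj ir by blast
    then show "x = y" using ir \<pi>[OF ir(2)] by (auto simp: bij_betw_def dest: inj_onD)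
  qed
  moreover have "\<tau> ` {1..n * d} \<subseteq> {1..n * d}"
  proof
    fix y assume "y \<in> \<tau> ` {1..n * d}"
    then obtain i r where ir: "i \<in> {1..n}" "r < d" "y = \<tau> (r * n + i)"
      unfolding cell_image[symmetric] by auto
    then have "y = ?c (i, \<pi> i r)" "(i, \<pi> i r) \<in> {1..n} \<times> {..<d}" using val lt by auto
    then show "y \<in> {1..n * d}" unfolding cell_image[symmetric] by blast
  qed
  ultimately have "bij_betw \<tau> {1..n * d} {1..n * d}"
    by (simp add: bij_betw_def endo_inj_surj)
  then show "\<tau> permutes {1..n * d}" by (rule bij_imp_permutes) (auto simp: \<tau>_def)
qed

section \<open>A combinatorial criterion for smooth spreadability\<close>

text \<open>
  For each variable the blocks form a chain in which blocks of equal size coincide. Both properties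
  are expressed by the one comparison, since the size of a block is the exponent.
\<close>
definition block_chains :: "nat \<Rightarrow> mon set \<Rightarrow> bool" where
  "block_chains n U \<longleftrightarrow>
     (\<forall>i\<in>{1..n}. \<forall>u\<in>U. \<forall>v\<in>U. lookup u i \<le> lookup v i \<longrightarrow> block u i \<subseteq> block v i)"

text \<open>
  A level in the block of \<open>i\<close> in \<open>u\<close> goes to a level below the exponent of \<open>x\<^sub>i\<close> in \<open>u\<close>, hence below
  that in \<open>v\<close>; as \<open>\<tau>\<close> is injective, the level belongs to the block in \<open>v\<close>.
\<close>
lemma block_chains_if_permutation:
  assumes U: "\<And>u. u \<in> U \<Longrightarrow> mdeg u \<le> d"
    and \<tau>: "\<tau> permutes {1..n * d}" "\<And>x. x \<in> {1..n * d} \<Longrightarrow> [\<tau> x = x] (mod n)"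
    and maps: "\<And>u. u \<in> U \<Longrightarrow> \<tau> ` cells n (block u) = cells n (\<lambda>i. {..<lookup u i})"
  shows "block_chains n U"
  unfolding block_chains_def
proof (intro ballI impI subsetI)
  fix i u v r
  assume i: "i \<in> {1..n}" and uv: "u \<in> U" "v \<in> U" "lookup u i \<le> lookup v i" and r: "r \<in> block u i"
  have sub: "cells n (block u) \<subseteq> {1..n * d}"
    using block_subset U[OF uv(1)] by (intro cells_subset) fastforce
  have cell: "r * n + i \<in> cells n (block u)" using i r by (simp add: cell_in_cells_iff)
  then have "\<tau> (r * n + i) \<in> cells n (\<lambda>i. {..<lookup u i})" using maps[OF uv(1)] by blast
  then obtain i' r' where ir': "\<tau> (r * n + i) = r' * n + i'" "i' \<in> {1..n}" "r' < lookup u i'"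
    by (auto simp: cells_def)
  \<comment> \<open>The image lies above the same variable because residues are preserved.\<close>
  have "[r' * n + i' = r * n + i] (mod n)" using \<tau>(2) sub cell ir'(1) by (metis subsetD)
  then have "i' mod n = i mod n" by (simp add: cong_def)
  moreover obtain a a' where "i = Suc a" "i' = Suc a'" "a < n" "a' < n"
    using i ir'(2) by (cases i; cases i') auto
  ultimately have "i' = i"
    using cong_add_rcancel_nat[of a' 1 a n] by (simp add: cong_def)
  then have "\<tau> (r * n + i) \<in> cells n (\<lambda>i. {..<lookup v i})"
    using ir' i uv(3) by (simp add: cell_in_cells_iff)
  then have "\<tau> (r * n + i) \<in> \<tau> ` cells n (block v)" using maps[OF uv(2)] by simp
  then have "r * n + i \<in> cells n (block v)"
    using permutes_inj[OF \<tau>(1)] by (simp add: inj_image_mem_iff)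
  then show "r \<in> block v i" using i by (simp add: cell_in_cells_iff)
qed

lemma permutation_if_block_chains:
  assumes U: "\<And>u. u \<in> U \<Longrightarrow> mdeg u \<le> d" and chains: "block_chains n U"
  obtains \<tau> where "\<tau> permutes {1..n * d}" "\<And>x. x \<in> {1..n * d} \<Longrightarrow> [\<tau> x = x] (mod n)"
    "\<And>u. u \<in> U \<Longrightarrow> \<tau> ` cells n (block u) = cells n (\<lambda>i. {..<lookup u i})"
proof -
  have sub: "block u i \<subseteq> {..<d}" if "u \<in> U" for u i
    using block_subset[of u i] U[OF that] by auto
  have "\<exists>\<pi> :: nat \<Rightarrow> nat. bij_betw \<pi> {..<d} {..<d} \<and> (\<forall>u\<in>U. \<pi> ` block u i = {..<lookup u i})"
    if i: "i \<in> {1..n}" for i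
  proof -
    have "\<exists>\<pi> :: nat \<Rightarrow> nat. bij_betw \<pi> {..<d} {..<card {..<d}}
        \<and> (\<forall>X\<in>(\<lambda>u. block u i) ` U. \<pi> ` X = {..<card X})"
    proof (rule ex_bij_betw_initial_segments)
      fix X Y assume "X \<in> (\<lambda>u. block u i) ` U" "Y \<in> (\<lambda>u. block u i) ` U" "card X \<le> card Y"
      then obtain u v where uv: "u \<in> U" "v \<in> U" "X = block u i" "Y = block v i"
        and "lookup u i \<le> lookup v i"
        by (auto simp: card_block)
      then show "X \<subseteq> Y" using chains i unfolding block_chains_def by blast
    qed (use sub in auto)
    then show ?thesis by (simp add: card_block)
  qed
  then obtain \<pi> :: "nat \<Rightarrow> nat \<Rightarrow> nat" where
    \<pi>: "\<And>i. i \<in> {1..n} \<Longrightarrow> bij_betw (\<pi> i) {..<d} {..<d}"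
       "\<And>i u. i \<in> {1..n} \<Longrightarrow> u \<in> U \<Longrightarrow> \<pi> i ` block u i = {..<lookup u i}"
    by metis
  obtain \<tau> where \<tau>: "\<tau> permutes {1..n * d}"
    "\<And>i r. i \<in> {1..n} \<Longrightarrow> r < d \<Longrightarrow> \<tau> (r * n + i) = \<pi> i r * n + i"
    using ex_permutation_of_cells[of n \<pi> d] \<pi>(1) by blast
  show thesis
  proof
    show "[\<tau> x = x] (mod n)" if x: "x \<in> {1..n * d}" for x
    proof -
      obtain i r where "x = r * n + i" "i \<in> {1..n}" "r < d"
        using x unfolding cell_image[symmetric] by auto
      then show ?thesis using \<tau>(2)[of i r] by (simp add: cong_def)
    qed
    show "\<tau> ` cells n (block u) = cells n (\<lambda>i. {..<lookup u i})" if u: "u \<in> U" for u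
    proof -
      have "\<tau> ` cells n (block u) = (\<Union>i\<in>{1..n}. (\<lambda>r. \<tau> (r * n + i)) ` block u i)"
        by (force simp: cells_def)
      also have "\<dots> = (\<Union>i\<in>{1..n}. (\<lambda>r. r * n + i) ` \<pi> i ` block u i)"
        unfolding image_image using \<tau>(2) sub[OF u] by (intro SUP_cong image_cong) auto
      also have "\<dots> = (\<Union>i\<in>{1..n}. (\<lambda>r. r * n + i) ` {..<lookup u i})"
        using \<pi>(2) u by simp
      also have "\<dots> = cells n (\<lambda>i. {..<lookup u i})"
        by (force simp: cells_def)
      finally show ?thesis .
    qed
  qed (rule \<tau>(1))
qed

text \<open>
  The homomorphism condition on \<open>\<Phi>\<close> is a set equation for \<open>\<tau>\<close> by \<open>hom_of_mon_squarefree_mon\<close>, and a suitable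
  \<open>\<Phi>\<close> exists for every permutation \<open>\<tau>\<close> by \<open>K_algebra_iso_rename_vars\<close>. What remains is the combinatorics of
  \<open>block_chains_if_permutation\<close> and \<open>permutation_if_block_chains\<close>.
\<close>
lemma smoothly_spreadable_iff_block_chains:
  fixes I :: "'k::field mpoly set"
  assumes I: "monomial_ideal n I" "I \<noteq> {0}"
  shows "smoothly_spreadable n I \<longleftrightarrow> block_chains n (G n I)"
proof -
  let ?d = "ideal_deg n I"
  have deg: "mdeg u \<le> ?d" if "u \<in> G n I" for u using mdeg_le_ideal_deg[OF I(1) that] .
  have mons: "u \<in> mons n" if "u \<in> G n I" for u
    using that by (simp add: G_eq_dvd_minimal[OF I(1)] dvd_minimal_def)
  have spread: "(sigma ^^ n) u = squarefree_mon (cells n (block u))" if "u \<in> G n I" for u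
    using sigma_funpow_eq_squarefree_mon[OF mons[OF that]] .
  have cells: "cells n (block u) \<subseteq> {1..n * ?d}" if "u \<in> G n I" for u
    using block_subset deg[OF that] by (intro cells_subset) fastforce
  have of_mon_inj: "(of_mon u :: 'k mpoly) = of_mon v \<longleftrightarrow> u = v" for u v
    by (metis keys_of_mon singleton_inject)
  have image: "\<Phi> (of_mon ((sigma ^^ n) u)) = of_mon (polarization n u)
      \<longleftrightarrow> \<tau> ` cells n (block u) = cells n (\<lambda>i. {..<lookup u i})"
    if u: "u \<in> G n I" and \<tau>: "\<tau> permutes {1..n * ?d}" and \<Phi>: "K_algebra_iso (n * ?d) (n * ?d) \<Phi>"
      and var: "\<forall>i\<in>{1..n * ?d}. \<Phi> (of_mon (xpow i 1)) = of_mon (xpow (\<tau> i) 1)"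
    for u \<tau> and \<Phi> :: "'k mpoly \<Rightarrow> 'k mpoly"
  proof -
    have "\<Phi> \<in> ring_hom (T (n * ?d)) (T (n * ?d))"
      using \<Phi> by (simp add: K_algebra_iso_def ring_iso_def)
    then have "\<Phi> (of_mon ((sigma ^^ n) u)) = of_mon (squarefree_mon (\<tau> ` cells n (block u)))"
      unfolding spread[OF u]
      using hom_of_mon_squarefree_mon[OF _ var permutes_inj_on[OF \<tau>] cells[OF u]] by blast
    moreover have "finite (\<tau> ` cells n (block u))" "finite (cells n (\<lambda>i. {..<lookup u i}))"
      by (auto intro!: finite_cells finite_block)
    ultimately show ?thesis
      unfolding polarization_eq_squarefree_mon by (metis of_mon_inj squarefree_mon_inj)
  qed
  show ?thesis
  proof
    assume "smoothly_spreadable n I"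
    then obtain \<tau> and \<Phi> :: "'k mpoly \<Rightarrow> 'k mpoly" where
      \<tau>: "\<tau> permutes {1..n * ?d}" "\<forall>x\<in>{1..n * ?d}. [\<tau> x = x] (mod n)"
      and \<Phi>: "K_algebra_iso (n * ?d) (n * ?d) \<Phi>"
        "\<forall>i\<in>{1..n * ?d}. \<Phi> (of_mon (xpow i 1)) = of_mon (xpow (\<tau> i) 1)"
        "\<forall>u\<in>G n I. \<Phi> (of_mon ((sigma ^^ n) u)) = of_mon (polarization n u)"
      unfolding smoothly_spreadable_def Let_def by blast
    show "block_chains n (G n I)"
    proof (rule block_chains_if_permutation[OF deg \<tau>(1)])
      show "\<tau> ` cells n (block u) = cells n (\<lambda>i. {..<lookup u i})" if "u \<in> G n I" for u
        using image[OF that \<tau>(1) \<Phi>(1,2)] \<Phi>(3) that by blast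
    qed (use \<tau>(2) in auto)
  next
    assume "block_chains n (G n I)"
    then obtain \<tau> where \<tau>: "\<tau> permutes {1..n * ?d}" "\<And>x. x \<in> {1..n * ?d} \<Longrightarrow> [\<tau> x = x] (mod n)"
      "\<And>u. u \<in> G n I \<Longrightarrow> \<tau> ` cells n (block u) = cells n (\<lambda>i. {..<lookup u i})"
      using permutation_if_block_chains[OF deg] by metis
    let ?\<Phi> = "rename_vars \<tau> :: 'k mpoly \<Rightarrow> 'k mpoly"
    have iso: "K_algebra_iso (n * ?d) (n * ?d) ?\<Phi>"
      by (rule K_algebra_iso_rename_vars[OF \<tau>(1)])
    have var: "\<forall>i\<in>{1..n * ?d}. ?\<Phi> (of_mon (xpow i 1)) = of_mon (xpow (\<tau> i) 1)"
      using permutes_bij[OF \<tau>(1)] by (simp add: of_mon_def rename_vars_single rename_xpow)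
    show "smoothly_spreadable n I"
      unfolding smoothly_spreadable_def Let_def
    proof (intro conjI exI[of _ \<tau>] exI[of _ ?\<Phi>] ballI)
      show "?\<Phi> (of_mon (xpow i 1)) = of_mon (xpow (\<tau> i) 1)" if "i \<in> {1..n * ?d}" for i
        using var that by blast
      show "?\<Phi> (of_mon ((sigma ^^ n) u)) = of_mon (polarization n u)" if "u \<in> G n I" for u
        using image[OF that \<tau>(1) iso var] \<tau>(3)[OF that] by (rule iffD2)
    qed (fact I \<tau>(1) iso | erule \<tau>(2))+
  qed
qed


section \<open>Adding pure powers\<close>

lemma genideal_Un_genideal:
  assumes "cring R" "A \<subseteq> carrier R" "B \<subseteq> carrier R"
  shows "genideal R (genideal R A \<union> B) = genideal R (A \<union> B)"
proof -
  interpret R: cring R by fact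
  have A: "genideal R A \<subseteq> carrier R"
    using ideal.Icarr[OF R.genideal_ideal[OF assms(2)]] by blast
  show ?thesis
  proof
    have "ideal (genideal R (A \<union> B)) R" using assms by (intro R.genideal_ideal) blast
    moreover have "A \<union> B \<subseteq> genideal R (A \<union> B)" using assms by (intro R.genideal_self) blast
    moreover from calculation have "genideal R A \<subseteq> genideal R (A \<union> B)"
      by (intro R.genideal_minimal) auto
    ultimately show "genideal R (genideal R A \<union> B) \<subseteq> genideal R (A \<union> B)"
      by (intro R.genideal_minimal) auto
  next
    have "ideal (genideal R (genideal R A \<union> B)) R" using A assms by (intro R.genideal_ideal) blast
    moreover have "genideal R A \<union> B \<subseteq> genideal R (genideal R A \<union> B)"
      using A assms by (intro R.genideal_self) blast
    moreover have "A \<subseteq> genideal R A" using assms by (intro R.genideal_self)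
    ultimately show "genideal R (A \<union> B) \<subseteq> genideal R (genideal R A \<union> B)"
      by (intro R.genideal_minimal) auto
  qed
qed

lemma monomial_ideal_Un_mons:
  fixes I :: "'k::field mpoly set"
  assumes "monomial_ideal n I" "P \<subseteq> mons n"
  shows "monomial_ideal n (genideal (T n) (I \<union> of_mon ` P))" "I \<subseteq> genideal (T n) (I \<union> of_mon ` P)"
proof -
  obtain M where M: "M \<subseteq> mons n" "I = genideal (T n) (of_mon ` M)"
    using assms(1) by (auto simp: monomial_ideal_def mon_ideal_gen_def)
  have carrier: "(of_mon ` N :: 'k mpoly set) \<subseteq> carrier (T n)" if "N \<subseteq> mons n" for N
    using that by auto
  interpret R: cring "T n :: 'k mpoly ring" by (rule cring_T)
  have "genideal (T n) (I \<union> of_mon ` P) = mon_ideal_gen n (M \<union> P)"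
    unfolding M(2) mon_ideal_gen_def image_Un
    by (rule genideal_Un_genideal[OF cring_T carrier[OF M(1)] carrier[OF assms(2)]])
  with M(1) assms(2) show "monomial_ideal n (genideal (T n) (I \<union> of_mon ` P))"
    unfolding monomial_ideal_def by blast
  have "I \<subseteq> carrier (T n)"
    using ideal.Icarr[OF R.genideal_ideal[OF carrier[OF M(1)]]] unfolding M(2) by blast
  then have "I \<union> of_mon ` P \<subseteq> genideal (T n) (I \<union> of_mon ` P)"
    using carrier[OF assms(2)] by (intro R.genideal_self) blast
  then show "I \<subseteq> genideal (T n) (I \<union> of_mon ` P)" by blast
qed

lemma block_chains_mono: "block_chains n V \<Longrightarrow> U \<subseteq> V \<Longrightarrow> block_chains n U"
  unfolding block_chains_def by blast

text \<open>
  The block of \<open>i\<close> in \<open>x\<^sub>i\<^sup>e\<close> is \<open>{..<e}\<close>. By the bound it contains the blocks of \<open>i\<close> in all elements of \<open>U\<close>.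
  If such a block has size at least \<open>e\<close>, then it equals \<open>{..<e}\<close>, so blocks of equal size
  still coincide. Injectivity of \<open>j\<close> ensures that each variable receives at most one new power.
\<close>
lemma block_chains_Un_xpows:
  assumes chains: "block_chains n U" and j: "inj_on j L"
    and bound: "\<And>l u. l \<in> L \<Longrightarrow> u \<in> U \<Longrightarrow> block u (j l) \<subseteq> {..<e l}"
  shows "block_chains n (U \<union> (\<lambda>l. xpow (j l) (e l)) ` L)"
  unfolding block_chains_def
proof (intro ballI impI)
  fix i u v
  assume i: "i \<in> {1..n}" and le: "lookup u i \<le> lookup v i"
    and u: "u \<in> U \<union> (\<lambda>l. xpow (j l) (e l)) ` L" and v: "v \<in> U \<union> (\<lambda>l. xpow (j l) (e l)) ` L"
  show "block u i \<subseteq> block v i"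
  proof (cases "lookup u i = 0")
    case True
    then show ?thesis by (simp add: block_eq_empty)
  next
    case False
    have power: "w \<in> U \<or> (\<exists>l\<in>L. i = j l \<and> w = xpow (j l) (e l))"
      if "w \<in> U \<union> (\<lambda>l. xpow (j l) (e l)) ` L" "lookup w i \<noteq> 0" for w
      using that by (auto simp: lookup_xpow split: if_splits)
    consider "u \<in> U" "v \<in> U"
      | l where "l \<in> L" "i = j l" "u \<in> U" "v = xpow (j l) (e l)"
      | l where "l \<in> L" "i = j l" "u = xpow (j l) (e l)" "v \<in> U"
      | l l' where "l \<in> L" "i = j l" "u = xpow (j l) (e l)" "l' \<in> L" "i = j l'" "v = xpow (j l') (e l')"
      using power[OF u] power[OF v] False le by auto
    then show ?thesis
    proof cases
      case 1
      then show ?thesis using chains i le unfolding block_chains_def by blast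
    next
      case 2
      then show ?thesis using bound by (simp add: block_xpow)
    next
      case (3 l)
      then have "block v i \<subseteq> {..<e l}" "card {..<e l} \<le> card (block v i)"
        using bound le by (simp_all add: card_block lookup_xpow)
      then have "block v i = {..<e l}" by (intro card_seteq) auto
      with 3 show ?thesis by (simp add: block_xpow)
    next
      case (4 l l')
      then have "l = l'" using j by (auto dest: inj_onD)
      with 4 show ?thesis by simp
    qed
  qed
qed

theorem proposition1p14:
  fixes n k d :: nat
    and j e :: "nat \<Rightarrow> nat"
    and I J :: "'k::field mpoly set"
  assumes I: "monomial_ideal n I" "I \<noteq> {0}"
    and deg_I: "ideal_deg n I = d"
    and k: "1 \<le> k" "k \<le> n"
    and j: "\<And>l. l \<in> {1..k} \<Longrightarrow> 1 \<le> j l \<and> j l \<le> n" "strict_mono_on {1..k} j"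
    and e: "\<And>l. l \<in> {1..k} \<Longrightarrow> 1 \<le> e l"
    and J: "J = genideal (T n) (I \<union> {of_mon (xpow (j l) (e l)) | l. l \<in> {1..k}})"
    and G_J: "G n J = G n I \<union> {xpow (j l) (e l) | l. l \<in> {1..k}}"
  shows "((\<forall>l\<in>{1..k}.
             (let S = {mdeg (set_to_one {j l + 1..n} u) | u. u \<in> G n I \<and> mon_dvd (xpow (j l) 1) u}
              in S \<noteq> {} \<longrightarrow> e l \<ge> Max S)) \<longrightarrow>
          smoothly_spreadable n I \<longrightarrow> smoothly_spreadable n J)
       \<and> (smoothly_spreadable n J \<longrightarrow> smoothly_spreadable n I)"
proof -
  define P where "P = (\<lambda>l. xpow (j l) (e l)) ` {1..k}"
  have P: "P \<subseteq> mons n" using j(1) by (auto simp: P_def mons_def xpow_def split: if_splits)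
  have J': "J = genideal (T n) (I \<union> of_mon ` P)"
    unfolding J P_def image_image by (simp only: Setcompr_eq_image)
  have G_J': "G n J = G n I \<union> P"
    unfolding G_J P_def by (simp only: Setcompr_eq_image)
  have J_mon: "monomial_ideal n J" and "I \<subseteq> J"
    unfolding J' by (rule monomial_ideal_Un_mons[OF I(1) P])+
  moreover have "0 \<in> I"
    using I(1) by (auto simp: monomial_ideal_def mon_ideal_gen_eq)
  ultimately have "J \<noteq> {0}" using I(2) by blast
  note iff_J = smoothly_spreadable_iff_block_chains[OF J_mon this]
  note iff_I = smoothly_spreadable_iff_block_chains[OF I]
  have bound: "block u (j l) \<subseteq> {..<e l}"
    if cond: "\<forall>l\<in>{1..k}.
             (let S = {mdeg (set_to_one {j l + 1..n} u) | u. u \<in> G n I \<and> mon_dvd (xpow (j l) 1) u}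
              in S \<noteq> {} \<longrightarrow> e l \<ge> Max S)"
      and l: "l \<in> {1..k}" and u: "u \<in> G n I" for l u
  proof (cases "lookup u (j l) = 0")
    case True
    then show ?thesis by (simp add: block_eq_empty)
  next
    case False
    let ?S = "{mdeg (set_to_one {j l + 1..n} u) | u. u \<in> G n I \<and> mon_dvd (xpow (j l) 1) u}"
    have "mon_dvd (xpow (j l) 1) u" using False by (simp add: mon_dvd_iff lookup_xpow)
    then have S: "mdeg (set_to_one {j l + 1..n} u) \<in> ?S" using u by blast
    have "finite ?S" using finite_G[OF I(1)] by simp
    then have "mdeg (set_to_one {j l + 1..n} u) \<le> Max ?S" using S by (rule Max_ge)
    also have "\<dots> \<le> e l" using cond l S unfolding Let_def by blast
    finally have "mdeg (set_to_one {j l + 1..n} u) \<le> e l" .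
    moreover have "u \<in> mons n"
      using u by (simp add: G_eq_dvd_minimal[OF I(1)] dvd_minimal_def)
    ultimately show ?thesis using block_subset_mdeg_set_to_one[of u n "j l"] by auto
  qed
  show ?thesis
  proof (intro conjI impI)
    assume "\<forall>l\<in>{1..k}.
             (let S = {mdeg (set_to_one {j l + 1..n} u) | u. u \<in> G n I \<and> mon_dvd (xpow (j l) 1) u}
              in S \<noteq> {} \<longrightarrow> e l \<ge> Max S)"
      and "smoothly_spreadable n I"
    then show "smoothly_spreadable n J"
      unfolding iff_J iff_I G_J' P_def
      using block_chains_Un_xpows[of n "G n I" j "{1..k}" e] bound strict_mono_on_imp_inj_on[OF j(2)]
      by blast
  next
    assume "smoothly_spreadable n J"
    then show "smoothly_spreadable n I"
      unfolding iff_J iff_I G_J' by (rule block_chains_mono) blast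
  qed
qed

end
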